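(* Let $(X_t)_{t\in T}$ be a family of topological spaces, let $X\subseteq\prod_{t\in T}X_t$ be an $\mathcal S$-open set, let $\mathcal T$ be a topology on $X$ such that $(X,\mathcal T)$ is locally projectively symmetric, let $(Y,d)$ be a metric space, and let $f:(X,\mathcal T)\to Y$ be a mapping which is strongly separately continuous at the point $a=(a_t)_{t\in T}\in X$. Then $f$ is continuous at $a$ (as a mapping on $(X,\mathcal T)$) if and only if the following holds: for every $\varepsilon>0$ there exist a finite set $T_0\subseteq T$ and a neighborhood $U$ of $a$ in $(X,\mathcal T)$ such that $d\bigl(f(a),f(x_{T_0}^{a})\bigr)<\varepsilon$ for all $x\in U$.
   Context: For points $x=(x_t)_{t\in T}$, $a=(a_t)_{t\in T}$ of $\prod_{t\in T}X_t$ and $S\subseteq T$, $x_S^a$ denotes the point of the product whose $t$-th coordinate is $a_t$ if $t\in S$ and $x_t$ if $t\in T\setminus S$; for $S=\{s\}$ one writes $x_s^a$. A set $A\subseteq\prod_{t\in T}X_t$ is $\mathcal S$-open if for every $x\in A$ the set $A$ contains every point of the product that differs from $x$ in at most one coordinate. Let $X$ be $\mathcal S$-open, $\mathcal T$ a topology on $X$ and $(Y,d)$ a metric space. A mapping $f:(X,\mathcal T)\to Y$ is strongly separately continuous at $a\in X$ with respect to the $t$-th variable if $\lim_{x\to a}d(f(x),f(x_t^a))=0$, the limit being taken in $(X,\mathcal T)$, i.e. for every $\varepsilon>0$ there is a $\mathcal T$-neighborhood $U$ of $a$ with $d(f(x),f(x_t^a))<\varepsilon$ for all $x\in U$. It is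 strongly separately continuous at $a$ if this holds for every $t\in T$. A set $A\subseteq \prod_{t\in T}X_t$ is projectively symmetric with respect to a point $a\in A$ if $x_t^a\in A$ for all $t\in T$ and all $x\in A$. The space $(X,\mathcal T)$ is locally projectively symmetric if every $x\in X$ has a base of $\mathcal T$-neighborhoods that are projectively symmetric with respect to $x$. *)

theory Defs
  imports "HOL-Analysis.Analysis"
begin

text \<open>
  Points of a product over the index set \<open>T\<close> are extensional functions, i.e. elements of
  \<open>PiE T S\<close>, where \<open>S t\<close> is the underlying set of the factor with index \<open>t\<close>. The point
  obtained from \<open>x\<close> by replacing the coordinates in \<open>R \<subseteq> T\<close> by those of \<open>a\<close> is
  \<open>override_on x a R\<close>.
\<close>

definition S_open :: "'t set \<Rightarrow> ('t \<Rightarrow> 'x set) \<Rightarrow> ('t \<Rightarrow> 'x) set \<Rightarrow> bool" where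
  "S_open T S A \<longleftrightarrow>
     A \<subseteq> PiE T S \<and>
     (\<forall>x\<in>A. \<forall>y\<in>PiE T S. (\<exists>s. {t \<in> T. x t \<noteq> y t} \<subseteq> {s}) \<longrightarrow> y \<in> A)"

definition projectively_symmetric ::
  "'t set \<Rightarrow> ('t \<Rightarrow> 'x set) \<Rightarrow> ('t \<Rightarrow> 'x) \<Rightarrow> ('t \<Rightarrow> 'x) set \<Rightarrow> bool" where
  "projectively_symmetric T S a A \<longleftrightarrow>
     A \<subseteq> PiE T S \<and> a \<in> A \<and> (\<forall>t\<in>T. \<forall>x\<in>A. override_on x a {t} \<in> A)"

text \<open>The basic neighbourhoods need not be open, just as in \<open>neighbourhood_base_at\<close>.\<close>

definition locally_projectively_symmetric ::
  "'t set \<Rightarrow> ('t \<Rightarrow> 'x set) \<Rightarrow> ('t \<Rightarrow> 'x) topology \<Rightarrow> bool" where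
  "locally_projectively_symmetric T S \<T> \<longleftrightarrow>
     (\<forall>x\<in>topspace \<T>. neighbourhood_base_at x (projectively_symmetric T S x) \<T>)"

definition neighbourhood_in :: "'a topology \<Rightarrow> 'a \<Rightarrow> 'a set \<Rightarrow> bool" where
  "neighbourhood_in \<T> a U \<longleftrightarrow>
     U \<subseteq> topspace \<T> \<and> (\<exists>V. openin \<T> V \<and> a \<in> V \<and> V \<subseteq> U)"

definition strongly_separately_continuous_wrt ::
  "('t \<Rightarrow> 'x) topology \<Rightarrow> ('y \<Rightarrow> 'y \<Rightarrow> real) \<Rightarrow> (('t \<Rightarrow> 'x) \<Rightarrow> 'y) \<Rightarrow> ('t \<Rightarrow> 'x) \<Rightarrow> 't \<Rightarrow> bool" where
  "strongly_separately_continuous_wrt \<T> d f a t \<longleftrightarrow>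
     (\<forall>\<epsilon>>0. \<exists>U. neighbourhood_in \<T> a U \<and> (\<forall>x\<in>U. d (f x) (f (override_on x a {t})) < \<epsilon>))"

definition strongly_separately_continuous_at ::
  "'t set \<Rightarrow> ('t \<Rightarrow> 'x) topology \<Rightarrow> ('y \<Rightarrow> 'y \<Rightarrow> real) \<Rightarrow> (('t \<Rightarrow> 'x) \<Rightarrow> 'y) \<Rightarrow> ('t \<Rightarrow> 'x) \<Rightarrow> bool" where
  "strongly_separately_continuous_at T \<T> d f a \<longleftrightarrow>
     (\<forall>t\<in>T. strongly_separately_continuous_wrt \<T> d f a t)"

end

theory Submission
  imports Defs
begin

text \<open>
  Replacing the coordinates in a finite set \<open>R\<close> one at a time inside projectively symmetric
  neighbourhoods, strong separate continuity and the triangle inequality show that \<open>f x\<close> and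
  \<open>f (override_on x a R)\<close> are arbitrarily close for \<open>x\<close> near \<open>a\<close>. So \<open>f\<close> is continuous at
  \<open>a\<close> as soon as \<open>f (override_on x a R)\<close> is close to \<open>f a\<close>; conversely \<open>R = {}\<close> will do.
\<close>

lemma neighbourhood_in_Int:
  assumes "neighbourhood_in \<T> a U" "neighbourhood_in \<T> a V"
  shows "neighbourhood_in \<T> a (U \<inter> V)"
proof -
  obtain U' V' where "openin \<T> U'" "a \<in> U'" "U' \<subseteq> U" "openin \<T> V'" "a \<in> V'" "V' \<subseteq> V"
    using assms unfolding neighbourhood_in_def by blast
  then have "openin \<T> (U' \<inter> V')" "a \<in> U' \<inter> V'" "U' \<inter> V' \<subseteq> U \<inter> V"
    by auto
  then show ?thesis
    using assms unfolding neighbourhood_in_def by blast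
qed

text \<open>Shrinking to such a \<open>W\<close> gives a neighbourhood stable under replacing one
  coordinate by that of \<open>a\<close>, so estimates valid on \<open>U\<close> may also be applied
  to the modified points.\<close>

lemma projectively_symmetric_neighbourhood:
  assumes "locally_projectively_symmetric T S \<T>" "neighbourhood_in \<T> a U"
  obtains W where "neighbourhood_in \<T> a W" "projectively_symmetric T S a W" "W \<subseteq> U"
proof -
  obtain V where V: "openin \<T> V" "a \<in> V" "V \<subseteq> U"
    using assms(2) unfolding neighbourhood_in_def by blast
  then have "a \<in> topspace \<T>"
    using openin_subset by blast
  then have "neighbourhood_base_at a (projectively_symmetric T S a) \<T>"
    using assms(1) unfolding locally_projectively_symmetric_def by blast
  then obtain O' W where "openin \<T> O'" "projectively_symmetric T S a W" "a \<in> O'" "O' \<subseteq> W" "W \<subseteq> V"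
    using V unfolding neighbourhood_base_at_def by metis
  moreover have "V \<subseteq> topspace \<T>"
    using V(1) by (rule openin_subset)
  ultimately show ?thesis
    using V(3) by (intro that[of W]) (auto simp: neighbourhood_in_def)
qed

text \<open>Membership in \<open>topspace \<T>\<close> is carried through the induction because the
  triangle inequality is available only for points of \<open>Y\<close>. The bound
  \<open>\<epsilon>\<close> stays arbitrary so that each step can spend half of it on the new
  coordinate.\<close>

lemma strongly_separately_continuous_finite_override:
  assumes "Metric_space Y d" "f \<in> topspace \<T> \<rightarrow> Y" "a \<in> topspace \<T>"
    and lps: "locally_projectively_symmetric T S \<T>"
    and ssc: "strongly_separately_continuous_at T \<T> d f a"
    and "finite R" "R \<subseteq> T" "\<epsilon> > 0"
  shows "\<exists>U. neighbourhood_in \<T> a U \<and>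
    (\<forall>x\<in>U. override_on x a R \<in> topspace \<T> \<and> d (f x) (f (override_on x a R)) < \<epsilon>)"
  using assms(6-8)
proof (induction R arbitrary: \<epsilon> rule: finite_induct)
  case empty
  interpret Metric_space Y d by fact
  have "neighbourhood_in \<T> a (topspace \<T>)"
    using assms(3) unfolding neighbourhood_in_def by blast
  moreover have "d (f x) (f x) < \<epsilon>" if "x \<in> topspace \<T>" for x
    using that assms(2) empty by (simp add: Pi_iff)
  ultimately show ?case by (intro exI[of _ "topspace \<T>"]) simp
next
  case (insert t R)
  interpret Metric_space Y d by fact
  obtain U where U: "neighbourhood_in \<T> a U"
    "\<And>x. x \<in> U \<Longrightarrow> override_on x a R \<in> topspace \<T> \<and> d (f x) (f (override_on x a R)) < \<epsilon> / 2"
    using insert.IH[of "\<epsilon> / 2"] insert.prems by auto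
  have "\<epsilon> / 2 > 0" "t \<in> T"
    using insert.prems by auto
  then obtain V where V: "neighbourhood_in \<T> a V"
    "\<And>x. x \<in> V \<Longrightarrow> d (f x) (f (override_on x a {t})) < \<epsilon> / 2"
    using ssc unfolding strongly_separately_continuous_at_def strongly_separately_continuous_wrt_def
    by meson
  \<comment> \<open>Symmetry of \<open>W\<close> matters here: for \<open>x\<close> in
    \<open>W\<close> the point with coordinate \<open>t\<close> replaced stays in \<open>U\<close>,
    where the induction hypothesis applies to it.\<close>
  obtain W where W: "neighbourhood_in \<T> a W" "projectively_symmetric T S a W" "W \<subseteq> U \<inter> V"
    using projectively_symmetric_neighbourhood[OF lps neighbourhood_in_Int[OF U(1) V(1)]] by blast
  show ?case
  proof (intro exI[of _ W] conjI ballI)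
    show "neighbourhood_in \<T> a W" by (fact W(1))
  next
    fix x assume x: "x \<in> W"
    define y where "y = override_on x a {t}"
    have y: "y \<in> W"
      using W(2) x \<open>t \<in> T\<close> unfolding projectively_symmetric_def y_def by blast
    \<comment> \<open>All replaced coordinates come from the same point \<open>a\<close>, so
      replacing at \<open>t\<close> first and then on \<open>R\<close> replaces on
      \<open>insert t R\<close>.\<close>
    have yR: "override_on x a (insert t R) = override_on y a R"
      by (auto simp: y_def override_on_def)
    show "override_on x a (insert t R) \<in> topspace \<T>"
      using U(2) y W(3) yR by auto
    moreover have "x \<in> topspace \<T>" "y \<in> topspace \<T>"
      using W(1) x y unfolding neighbourhood_in_def by auto
    ultimately have "d (f x) (f (override_on y a R)) \<le> d (f x) (f y) + d (f y) (f (override_on y a R))"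
      using assms(2) yR by (intro triangle) auto
    also have "\<dots> < \<epsilon> / 2 + \<epsilon> / 2"
      using U(2)[of y] V(2)[of x] x y W(3) by (intro add_strict_mono) (auto simp: y_def)
    finally show "d (f x) (f (override_on x a (insert t R))) < \<epsilon>"
      by (simp add: yR)
  qed
qed

text \<open>Balls around \<open>f a\<close> form a neighbourhood base in the metric topology. This
  puts continuity into the same form as the criterion of the theorem, with \<open>f x\<close> in
  place of the value at the overridden point.\<close>

lemma topcontinuous_at_mtopology_iff:
  assumes "Metric_space Y d" "f \<in> topspace \<T> \<rightarrow> Y" "a \<in> topspace \<T>"
  shows "topcontinuous_at \<T> (Metric_space.mtopology Y d) f a \<longleftrightarrow>
    (\<forall>\<epsilon>>0. \<exists>U. neighbourhood_in \<T> a U \<and> (\<forall>x\<in>U. d (f a) (f x) < \<epsilon>))"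
proof
  interpret Metric_space Y d by fact
  assume cont: "topcontinuous_at \<T> mtopology f a"
  show "\<forall>\<epsilon>>0. \<exists>U. neighbourhood_in \<T> a U \<and> (\<forall>x\<in>U. d (f a) (f x) < \<epsilon>)"
  proof (intro allI impI)
    fix \<epsilon> :: real assume "\<epsilon> > 0"
    then have "f a \<in> mball (f a) \<epsilon>"
      using assms(2,3) by (simp add: Pi_iff)
    then obtain U where U: "openin \<T> U" "a \<in> U" "\<forall>x\<in>U. f x \<in> mball (f a) \<epsilon>"
      using cont openin_mball unfolding topcontinuous_at_def by meson
    then have "neighbourhood_in \<T> a U"
      unfolding neighbourhood_in_def using openin_subset by blast
    with U(3) show "\<exists>U. neighbourhood_in \<T> a U \<and> (\<forall>x\<in>U. d (f a) (f x) < \<epsilon>)"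
      by (intro exI[of _ U]) auto
  qed
next
  interpret Metric_space Y d by fact
  assume close: "\<forall>\<epsilon>>0. \<exists>U. neighbourhood_in \<T> a U \<and> (\<forall>x\<in>U. d (f a) (f x) < \<epsilon>)"
  have "\<exists>U. openin \<T> U \<and> a \<in> U \<and> (\<forall>x\<in>U. f x \<in> V)" if V: "openin mtopology V" "f a \<in> V" for V
  proof -
    obtain r where r: "r > 0" "mball (f a) r \<subseteq> V"
      using V unfolding openin_mtopology by blast
    then obtain N where N: "neighbourhood_in \<T> a N" "\<forall>x\<in>N. d (f a) (f x) < r"
      using close by blast
    then obtain U where U: "openin \<T> U" "a \<in> U" "U \<subseteq> N"
      unfolding neighbourhood_in_def by blast
    \<comment> \<open>Lying in a ball includes lying in \<open>Y\<close>, which holds because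
      \<open>U\<close> consists of points of \<open>topspace \<T>\<close>.\<close>
    have "f x \<in> mball (f a) r" if "x \<in> U" for x
      using that N(2) U openin_subset[OF U(1)] assms(2,3) by auto
    with U r(2) show ?thesis by blast
  qed
  then show "topcontinuous_at \<T> mtopology f a"
    using assms(2,3) unfolding topcontinuous_at_def by auto
qed

theorem theorem3p5:
  fixes T :: "'t set"
    and Xt :: "'t \<Rightarrow> 'x topology"
    and X :: "('t \<Rightarrow> 'x) set"
    and \<T> :: "('t \<Rightarrow> 'x) topology"
    and Y :: "'y set"
    and d :: "'y \<Rightarrow> 'y \<Rightarrow> real"
    and f :: "('t \<Rightarrow> 'x) \<Rightarrow> 'y"
    and a :: "'t \<Rightarrow> 'x"
  assumes "S_open T (\<lambda>t. topspace (Xt t)) X"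
    and "topspace \<T> = X"
    and "locally_projectively_symmetric T (\<lambda>t. topspace (Xt t)) \<T>"
    and "Metric_space Y d"
    and "f \<in> X \<rightarrow> Y"
    and "a \<in> X"
    and "strongly_separately_continuous_at T \<T> d f a"
  shows "topcontinuous_at \<T> (Metric_space.mtopology Y d) f a \<longleftrightarrow>
    (\<forall>\<epsilon>>0. \<exists>T0 U. finite T0 \<and> T0 \<subseteq> T \<and> neighbourhood_in \<T> a U \<and>
       (\<forall>x\<in>U. d (f a) (f (override_on x a T0)) < \<epsilon>))"
proof -
  interpret Metric_space Y d by fact
  have fY: "f \<in> topspace \<T> \<rightarrow> Y" and a: "a \<in> topspace \<T>"
    using assms by auto
  show ?thesis
    unfolding topcontinuous_at_mtopology_iff[OF assms(4) fY a]
  proof (intro iffI allI impI)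
    fix \<epsilon> :: real
    assume "\<forall>\<epsilon>>0. \<exists>U. neighbourhood_in \<T> a U \<and> (\<forall>x\<in>U. d (f a) (f x) < \<epsilon>)" "\<epsilon> > 0"
    then obtain U where "neighbourhood_in \<T> a U" "\<forall>x\<in>U. d (f a) (f x) < \<epsilon>"
      by blast
    then show "\<exists>T0 U. finite T0 \<and> T0 \<subseteq> T \<and> neighbourhood_in \<T> a U \<and>
       (\<forall>x\<in>U. d (f a) (f (override_on x a T0)) < \<epsilon>)"
      \<comment> \<open>Overriding on the empty set leaves \<open>x\<close> unchanged.\<close>
      by (intro exI[of _ "{}"] exI[of _ U]) simp
  next
    fix \<epsilon> :: real
    assume H: "\<forall>\<epsilon>>0. \<exists>T0 U. finite T0 \<and> T0 \<subseteq> T \<and> neighbourhood_in \<T> a U \<and>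
       (\<forall>x\<in>U. d (f a) (f (override_on x a T0)) < \<epsilon>)" and "\<epsilon> > 0"
    then have "\<epsilon> / 2 > 0" by simp
    with H obtain R U where R: "finite R" "R \<subseteq> T" and U: "neighbourhood_in \<T> a U"
      "\<And>x. x \<in> U \<Longrightarrow> d (f a) (f (override_on x a R)) < \<epsilon> / 2"
      by meson
    \<comment> \<open>The finite set \<open>R\<close> is fixed by the criterion at
      \<open>\<epsilon> / 2\<close> first; only then is \<open>V\<close> chosen, depending on
      \<open>R\<close>.\<close>
    obtain V where V: "neighbourhood_in \<T> a V" "\<And>x. x \<in> V \<Longrightarrow>
        override_on x a R \<in> topspace \<T> \<and> d (f x) (f (override_on x a R)) < \<epsilon> / 2"
      using strongly_separately_continuous_finite_override
        [OF assms(4) fY a assms(3) assms(7) R \<open>\<epsilon> / 2 > 0\<close>] by blast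
    have "d (f a) (f x) < \<epsilon>" if x: "x \<in> U \<inter> V" for x
    proof -
      have "x \<in> topspace \<T>" "override_on x a R \<in> topspace \<T>"
        using x U(1) V(2) unfolding neighbourhood_in_def by auto
      then have "d (f a) (f x) \<le> d (f a) (f (override_on x a R)) + d (f x) (f (override_on x a R))"
        using fY a by (intro triangle') auto
      also have "\<dots> < \<epsilon> / 2 + \<epsilon> / 2"
        using x U(2) V(2) by (intro add_strict_mono) auto
      finally show ?thesis by simp
    qed
    then show "\<exists>U. neighbourhood_in \<T> a U \<and> (\<forall>x\<in>U. d (f a) (f x) < \<epsilon>)"
      using neighbourhood_in_Int[OF U(1) V(1)] by blast
  qed
qed

end
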